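(* Let $Y$ be a proximinal finite co-dimensional (closed linear) subspace of $c_0$. Then the map $\mathrm{cent}_{B_Y}(\cdot)$ is Hausdorff metric continuous on $\mathcal{CB}(\ell_\infty)$.
   Context: All Banach spaces are real; $Y\subseteq c_0\subseteq\ell_\infty$ carry the supremum norm. A subspace $Y$ of a Banach space $E$ is proximinal in $E$ if for each $x\in E$ there is $y\in Y$ with $\|x-y\|=\inf_{y'\in Y}\|x-y'\|$. For a Banach space $E$, $B_E$ is its closed unit ball and $\mathcal{CB}(E)$ is the class of non-empty closed bounded subsets of $E$, equipped with the Hausdorff metric $d_H(A,B)=\inf\{t>0: A\subseteq B+tB_E,\ B\subseteq A+tB_E\}$. For $v\in E$ and a non-empty bounded set $F\subseteq E$, $r(v,F)=\sup_{z\in F}\|v-z\|$. For a non-empty closed convex $V\subseteq E$: $\mathrm{rad}_V(F)=\inf_{v\in V}r(v,F)$ and $\mathrm{cent}_V(F)=\{v\in V: r(v,F)=\mathrm{rad}_V(F)\}$. The map $\mathrm{cent}_V(\cdot)$ is Hausdorff metric continuous on $\mathcal{CB}(E)$ if it takes values in $\mathcal{CB}(E)$ (in particular non-empty values) and is continuous as a single-valued map from $(\mathcal{CB}(E),d_H)$ to $(\mathcal{CB}(E),d_H)$. *)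

theory Defs
  imports "HOL-Analysis.Analysis"
begin

(* The order topology on nat is discrete, so the bounded continuous functions nat => real are
   exactly the bounded real sequences; the norm of bcontfun is the supremum norm.  The two lemmas
   below confirm this. *)
type_synonym ell_infty = "(nat, real) bcontfun"

lemma range_apply_ell_infty:
  "range (apply_bcontfun :: ell_infty \<Rightarrow> nat \<Rightarrow> real) = {x. bounded (range x)}"
proof -
  have "x \<in> bcontfun" if "bounded (range x)" for x :: "nat \<Rightarrow> real"
    using that by (simp add: bcontfun_def)
  then show ?thesis
    by (auto elim!: bcontfunE)
qed

lemma norm_ell_infty:
  fixes x :: ell_infty
  shows "norm x = (SUP n. \<bar>apply_bcontfun x n\<bar>)"
  unfolding norm_bcontfun_def dist_bcontfun.rep_eq by simp

definition c0 :: "ell_infty set" where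
  "c0 = {x. (\<lambda>n. apply_bcontfun x n) \<longlonglongrightarrow> 0}"

definition proximinal_in :: "'a::real_normed_vector set \<Rightarrow> 'a set \<Rightarrow> bool" where
  "proximinal_in Y E \<longleftrightarrow> (\<forall>x\<in>E. \<exists>y\<in>Y. norm (x - y) = (INF y'\<in>Y. norm (x - y')))"

(* For linear subspaces Y <= E: the quotient E/Y is spanned by the cosets of finitely many
   vectors of E, i.e. dim (E/Y) is finite. *)
definition finite_codimensional_in :: "'a::real_vector set \<Rightarrow> 'a set \<Rightarrow> bool" where
  "finite_codimensional_in Y E \<longleftrightarrow> (\<exists>B. finite B \<and> B \<subseteq> E \<and> span (Y \<union> B) = E)"

definition CB :: "'a::real_normed_vector set set" where
  "CB = {A. A \<noteq> {} \<and> closed A \<and> bounded A}"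

definition hausdorff_distance :: "'a::real_normed_vector set \<Rightarrow> 'a set \<Rightarrow> real" where
  "hausdorff_distance A B = Inf {t. t > 0 \<and>
     A \<subseteq> {b + t *\<^sub>R u |b u. b \<in> B \<and> u \<in> cball 0 1} \<and>
     B \<subseteq> {a + t *\<^sub>R u |a u. a \<in> A \<and> u \<in> cball 0 1}}"

definition outer_radius :: "'a::real_normed_vector \<Rightarrow> 'a set \<Rightarrow> real" where
  "outer_radius v F = (SUP z\<in>F. norm (v - z))"

definition rad :: "'a::real_normed_vector set \<Rightarrow> 'a set \<Rightarrow> real" where
  "rad V F = (INF v\<in>V. outer_radius v F)"

definition cent :: "'a::real_normed_vector set \<Rightarrow> 'a set \<Rightarrow> 'a set" where
  "cent V F = {v \<in> V. outer_radius v F = rad V F}"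

definition hausdorff_continuous_on_CB ::
    "('a::real_normed_vector set \<Rightarrow> 'a set) \<Rightarrow> bool" where
  "hausdorff_continuous_on_CB \<Phi> \<longleftrightarrow>
     (\<forall>F\<in>CB. \<Phi> F \<in> CB) \<and>
     (\<forall>F\<in>CB. \<forall>\<epsilon>>0. \<exists>\<delta>>0. \<forall>G\<in>CB.
        hausdorff_distance F G < \<delta> \<longrightarrow> hausdorff_distance (\<Phi> F) (\<Phi> G) < \<epsilon>)"

end

theory Submission
  imports Defs
begin

text \<open>
  A proximinal finite-codimensional subspace \<open>Y\<close> of \<open>c\<^sub>0\<close> contains all null sequences vanishing on the
  first \<open>N\<close> coordinates, for some \<open>N\<close>, so \<open>Y\<close> is the product of a subspace of \<open>\<real>\<^sup>N\<close> with \<open>c\<^sub>0\<close>.  The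
  condition that \<open>v \<in> B\<^sub>Y\<close> has \<open>outer_radius v F \<le> r\<close> says that \<open>v \<in> Y\<close> lies in a coordinate box
  depending on \<open>F\<close> and \<open>r\<close>.  If a point of \<open>Y\<close> violates the box by at most \<open>\<epsilon>\<close>, and the box meets \<open>Y\<close>,
  then it can be moved into the box within \<open>Y\<close> by at most \<open>K * \<epsilon>\<close>: the first \<open>N\<close> coordinates are
  handled by Hoffman's error bound for linear inequalities and the others by clamping.  Applied to
  a fixed set \<open>F\<close>, this bound shows that centers exist; applied to two sets at Hausdorff
  distance \<open>t\<close>, it shows that the sets of centers are at distance at most \<open>2 * K * t\<close>.
\<close>

section \<open>Centers and the Hausdorff distance\<close>

lemma bdd_above_norm_diff:
  fixes F :: "'a::real_normed_vector set"
  assumes "bounded F"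
  shows "bdd_above ((\<lambda>z. norm (v - z)) ` F)"
proof -
  obtain M where M: "\<And>z. z \<in> F \<Longrightarrow> norm z \<le> M"
    using assms by (auto simp: bounded_iff)
  have "norm (v - z) \<le> norm v + M" if "z \<in> F" for z
    using norm_triangle_ineq4[of v z] M[OF that] by linarith
  then show ?thesis by (rule bdd_aboveI2)
qed

lemma outer_radius_le_iff:
  assumes "F \<in> CB"
  shows "outer_radius v F \<le> r \<longleftrightarrow> (\<forall>z\<in>F. norm (v - z) \<le> r)"
  using assms unfolding outer_radius_def CB_def by (auto intro!: cSUP_le_iff bdd_above_norm_diff)

lemma outer_radius_nonneg:
  assumes "F \<in> CB"
  shows "0 \<le> outer_radius v F"
proof -
  obtain z where "z \<in> F" using assms by (auto simp: CB_def)
  then have "norm (v - z) \<le> outer_radius v F"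
    using outer_radius_le_iff[OF assms, of v "outer_radius v F"] by auto
  then show ?thesis using norm_ge_zero order_trans by blast
qed

lemma rad_le:
  assumes "F \<in> CB" "v \<in> V"
  shows "rad V F \<le> outer_radius v F"
  unfolding rad_def using assms
  by (auto intro!: cINF_lower bdd_belowI2[of _ 0] outer_radius_nonneg)

lemma le_rad:
  assumes "V \<noteq> {}" "\<And>v. v \<in> V \<Longrightarrow> r \<le> outer_radius v F"
  shows "r \<le> rad V F"
  unfolding rad_def using assms by (intro cINF_greatest)

text \<open>The radius is a lower bound for the outer radii, so only one inequality is left; in this
  form error bounds apply to centers.\<close>

lemma cent_eq:
  assumes "F \<in> CB"
  shows "cent V F = {v \<in> V. outer_radius v F \<le> rad V F}"
  unfolding cent_def using rad_le[OF assms] by force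

lemma ex_outer_radius_le:
  assumes "V \<noteq> {}" "r > rad V F"
  shows "\<exists>v\<in>V. outer_radius v F \<le> r"
  using le_rad[OF assms(1), of r F] assms(2) by force

section \<open>The Hausdorff distance in terms of norms\<close>

lemma subset_enlargement_iff:
  fixes A B :: "'a::real_normed_vector set"
  assumes "t > 0"
  shows "A \<subseteq> {b + t *\<^sub>R u |b u. b \<in> B \<and> u \<in> cball 0 1} \<longleftrightarrow> (\<forall>a\<in>A. \<exists>b\<in>B. norm (a - b) \<le> t)"
    (is "?L \<longleftrightarrow> ?R")
proof
  assume ?L
  show ?R
  proof
    fix a assume "a \<in> A"
    then obtain b u where "a = b + t *\<^sub>R u" "b \<in> B" "norm u \<le> 1"
      using \<open>?L\<close> by auto
    moreover have "norm (t *\<^sub>R u) \<le> t"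
      using \<open>t > 0\<close> \<open>norm u \<le> 1\<close> by (simp add: mult_left_le)
    ultimately show "\<exists>b\<in>B. norm (a - b) \<le> t" by (intro bexI[of _ b]) auto
  qed
next
  assume ?R
  show ?L
  proof
    fix a assume "a \<in> A"
    then obtain b where b: "b \<in> B" "norm (a - b) \<le> t" using \<open>?R\<close> by auto
    have "a = b + t *\<^sub>R ((1/t) *\<^sub>R (a - b))" using assms by simp
    moreover have "(1/t) *\<^sub>R (a - b) \<in> cball 0 1" using assms b
      by (simp add: divide_simps del: scaleR_right_diff_distrib)
    ultimately show "a \<in> {b + t *\<^sub>R u |b u. b \<in> B \<and> u \<in> cball 0 1}" using b by blast
  qed
qed

lemma hausdorff_distance_eq:
  fixes A B :: "'a::real_normed_vector set"
  shows "hausdorff_distance A B =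
    Inf {t. t > 0 \<and> (\<forall>a\<in>A. \<exists>b\<in>B. norm (a - b) \<le> t) \<and> (\<forall>b\<in>B. \<exists>a\<in>A. norm (b - a) \<le> t)}"
  unfolding hausdorff_distance_def
  by (intro arg_cong[where f = Inf] Collect_cong) (use subset_enlargement_iff in blast)

lemma hausdorff_distance_le:
  fixes A B :: "'a::real_normed_vector set"
  assumes "t > 0" "\<And>a. a \<in> A \<Longrightarrow> \<exists>b\<in>B. norm (a - b) \<le> t"
    and "\<And>b. b \<in> B \<Longrightarrow> \<exists>a\<in>A. norm (b - a) \<le> t"
  shows "hausdorff_distance A B \<le> t"
  unfolding hausdorff_distance_eq
  by (rule cInf_lower) (use assms in \<open>auto intro!: bdd_belowI[of _ 0]\<close>)

lemma hausdorff_distance_lessD: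
  fixes A B :: "'a::real_normed_vector set"
  assumes "A \<in> CB" "B \<in> CB" "hausdorff_distance A B < \<delta>"
  obtains t where "0 < t" "t < \<delta>" "\<And>a. a \<in> A \<Longrightarrow> \<exists>b\<in>B. norm (a - b) \<le> t"
    and "\<And>b. b \<in> B \<Longrightarrow> \<exists>a\<in>A. norm (b - a) \<le> t"
proof -
  let ?T = "{t. t > 0 \<and> (\<forall>a\<in>A. \<exists>b\<in>B. norm (a - b) \<le> t) \<and> (\<forall>b\<in>B. \<exists>a\<in>A. norm (b - a) \<le> t)}"
  have "bounded (A \<union> B)" using assms by (auto simp: CB_def)
  then obtain M where M: "M > 0" "\<And>z. z \<in> A \<union> B \<Longrightarrow> norm z \<le> M"
    by (meson bounded_pos)
  have dist: "norm (a - b) \<le> 2 * M" if "a \<in> A \<union> B" "b \<in> A \<union> B" for a b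
    using norm_triangle_ineq4[of a b] M(2)[OF that(1)] M(2)[OF that(2)] by linarith
  \<comment> \<open>\<open>Inf {}\<close> carries no information, so an admissible value must be
    exhibited before one below \<open>\<delta>\<close> can be extracted.\<close>
  have "2 * M \<in> ?T"
  proof -
    obtain a0 b0 where "a0 \<in> A" "b0 \<in> B" using assms(1,2) by (auto simp: CB_def)
    then show ?thesis using M(1) dist by (intro CollectI conjI ballI) (simp, blast, blast)
  qed
  then have "?T \<noteq> {}" by blast
  from cInf_lessD[OF this assms(3)[unfolded hausdorff_distance_eq]]
  obtain t where t: "t \<in> ?T" "t < \<delta>" by (elim bexE)
  show ?thesis by (rule that[of t]) (use t in simp_all)
qed

section \<open>Perturbation of radii; existence and continuity of centers\<close>

lemma outer_radius_le_add:
  assumes "F \<in> CB" "G \<in> CB" "\<And>z. z \<in> G \<Longrightarrow> \<exists>w\<in>F. norm (z - w) \<le> t"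
  shows "outer_radius v G \<le> outer_radius v F + t"
  unfolding outer_radius_le_iff[OF assms(2)]
proof
  fix z assume "z \<in> G"
  then obtain w where w: "w \<in> F" "norm (z - w) \<le> t" using assms(3) by blast
  have "norm (v - w) \<le> outer_radius v F"
    using outer_radius_le_iff[OF assms(1), of v "outer_radius v F"] w(1) by auto
  then show "norm (v - z) \<le> outer_radius v F + t"
    using w(2) norm_triangle_ineq4[of "v - w" "z - w"] by simp
qed

lemma rad_le_add:
  assumes "V \<noteq> {}" "F \<in> CB" "G \<in> CB" "\<And>z. z \<in> G \<Longrightarrow> \<exists>w\<in>F. norm (z - w) \<le> t"
  shows "rad V G \<le> rad V F + t"
proof -
  have "rad V G - t \<le> outer_radius v F" if "v \<in> V" for v
    using rad_le[OF assms(3) that] outer_radius_le_add[OF assms(2-4), of v] by linarith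
  from le_rad[OF assms(1) this] show ?thesis by linarith
qed

text \<open>
  Moving a point of outer radius \<open>rad V F + 2\<^sup>-\<^sup>n\<close> to one of outer radius \<open>rad V F + 2\<^sup>-\<^sup>n\<^sup>-\<^sup>1\<close> costs at
  most \<open>K * 2\<^sup>-\<^sup>n\<^sup>-\<^sup>1\<close>, so iterating yields a Cauchy sequence.
\<close>

lemma cent_nonempty:
  fixes V :: "'a::real_normed_vector set"
  assumes "complete V" "V \<noteq> {}" "F \<in> CB" "K \<ge> 0"
    and stable: "\<And>r \<epsilon> x z. 0 \<le> \<epsilon> \<Longrightarrow> x \<in> V \<Longrightarrow> outer_radius x F \<le> r + \<epsilon> \<Longrightarrow>
      z \<in> V \<Longrightarrow> outer_radius z F \<le> r \<Longrightarrow>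
      \<exists>y\<in>V. outer_radius y F \<le> r \<and> norm (x - y) \<le> K * \<epsilon>"
  shows "cent V F \<noteq> {}"
proof -
  let ?P = "\<lambda>n x. x \<in> V \<and> outer_radius x F \<le> rad V F + (1/2)^n"
  let ?Q = "\<lambda>n x y. norm (x - y) \<le> K * (1/2)^Suc n"
  have "\<exists>x. ?P 0 x \<and> True"
    using ex_outer_radius_le[OF \<open>V \<noteq> {}\<close>, of F "rad V F + 1"] by auto
  moreover have "\<exists>y. ?P (Suc n) y \<and> ?Q n x y" if "?P n x" for n x
  proof -
    obtain z where "z \<in> V" "outer_radius z F \<le> rad V F + (1/2)^Suc n"
      using ex_outer_radius_le[OF \<open>V \<noteq> {}\<close>, of F "rad V F + (1/2)^Suc n"] by auto
    with that show ?thesis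
      using stable[of "(1/2)^Suc n" x "rad V F + (1/2)^Suc n" z] by auto
  qed
  ultimately obtain x where x: "\<And>n. ?P n (x n)" and step: "\<And>n. ?Q n (x n) (x (Suc n))"
    using dependent_nat_choice[of ?P ?Q] by metis
  \<comment> \<open>Since \<open>(1/2)^Suc n = (1/2)^n - (1/2)^Suc n\<close>, the step bounds
    telescope.\<close>
  have diff: "norm (x n - x (n + k)) \<le> K * ((1/2)^n - (1/2)^(n + k))" for n k
  proof (induction k)
    case (Suc k)
    have "norm (x n - x (n + Suc k)) \<le> norm (x n - x (n + k)) + norm (x (n + k) - x (Suc (n + k)))"
      using norm_triangle_ineq[of "x n - x (n + k)" "x (n + k) - x (Suc (n + k))"] by simp
    also have "\<dots> \<le> K * ((1/2)^n - (1/2)^(n + k)) + K * (1/2)^Suc (n + k)"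
      by (intro add_mono Suc.IH step)
    also have "\<dots> = K * ((1/2)^n - (1/2)^(n + Suc k))" by (simp add: algebra_simps)
    finally show ?case .
  qed simp
  have "Cauchy x"
  proof (rule metric_CauchyI)
    have lim: "(\<lambda>n. K * (1/2)^n) \<longlonglongrightarrow> 0"
      by (intro tendsto_mult_right_zero LIMSEQ_power_zero) simp
    fix e :: real assume "e > 0"
    then obtain M where M: "K * (1/2)^M < e / 2"
      using order_tendstoD(2)[OF lim, of "e/2"] by (auto simp: eventually_sequentially)
    have "dist (x M) (x n) < e / 2" if "n \<ge> M" for n
    proof -
      have "dist (x M) (x n) \<le> K * ((1/2)^M - (1/2)^n)"
        using diff[of M "n - M"] that by (simp add: dist_norm)
      also have "\<dots> \<le> K * (1/2)^M" using \<open>K \<ge> 0\<close> by (intro mult_left_mono) auto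
      finally show ?thesis using M by simp
    qed
    then show "\<exists>M. \<forall>m\<ge>M. \<forall>n\<ge>M. dist (x m) (x n) < e"
      by (metis dist_triangle_half_r)
  qed
  then obtain l where "l \<in> V" and l: "x \<longlonglongrightarrow> l"
    using \<open>complete V\<close> x unfolding complete_def by blast
  note \<open>l \<in> V\<close>
  moreover have "norm (l - z) \<le> rad V F" if "z \<in> F" for z
  proof (rule LIMSEQ_le)
    show "(\<lambda>n. norm (x n - z)) \<longlonglongrightarrow> norm (l - z)" by (intro tendsto_intros l)
    have "(\<lambda>n. rad V F + (1/2)^n) \<longlonglongrightarrow> rad V F + 0"
      by (intro tendsto_intros LIMSEQ_power_zero) simp
    then show "(\<lambda>n. rad V F + (1/2)^n) \<longlonglongrightarrow> rad V F" by simp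
    show "\<exists>N. \<forall>n\<ge>N. norm (x n - z) \<le> rad V F + (1/2)^n"
      using x that outer_radius_le_iff[OF \<open>F \<in> CB\<close>] by blast
  qed
  ultimately show ?thesis
    unfolding cent_eq[OF \<open>F \<in> CB\<close>] outer_radius_le_iff[OF \<open>F \<in> CB\<close>] by blast
qed

text \<open>A center set is \<open>V\<close> cut by the closed balls of radius
  \<open>rad V F\<close> about the points of \<open>F\<close>.\<close>

lemma closed_cent:
  fixes V :: "'a::real_normed_vector set"
  assumes "closed V" "F \<in> CB"
  shows "closed (cent V F)"
proof -
  have "cent V F = V \<inter> (\<Inter>z\<in>F. cball z (rad V F))"
    unfolding cent_eq[OF assms(2)] outer_radius_le_iff[OF assms(2)]
    by (auto simp: dist_norm norm_minus_commute)
  then show ?thesis using assms(1) by (simp add: closed_Int closed_INT)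
qed

text \<open>The geometry of \<open>V\<close> enters through \<open>stable\<close>, whose
  \<open>K\<close> serves every \<open>F\<close>, \<open>r\<close> and \<open>\<epsilon>\<close> at
  once. For sets within \<open>t\<close> of each other, a center of one is an approximate center of
  the other up to \<open>2 * t\<close>, hence within \<open>K * (2 * t)\<close> of a true
  center.\<close>

lemma hausdorff_continuous_cent:
  fixes V :: "'a::real_normed_vector set"
  assumes "complete V" "V \<noteq> {}" "bounded V" "K > 0"
    and stable: "\<And>F r \<epsilon> x z. F \<in> CB \<Longrightarrow> 0 \<le> \<epsilon> \<Longrightarrow> x \<in> V \<Longrightarrow> outer_radius x F \<le> r + \<epsilon> \<Longrightarrow>
      z \<in> V \<Longrightarrow> outer_radius z F \<le> r \<Longrightarrow>
      \<exists>y\<in>V. outer_radius y F \<le> r \<and> norm (x - y) \<le> K * \<epsilon>"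
  shows "hausdorff_continuous_on_CB (cent V)"
proof -
  have nonempty: "cent V F \<noteq> {}" if "F \<in> CB" for F
    by (rule cent_nonempty[OF assms(1,2) that _ stable[OF that]]) (use \<open>K > 0\<close> in auto)
  have "cent V F \<in> CB" if "F \<in> CB" for F
    unfolding CB_def using nonempty[OF that] closed_cent[OF complete_imp_closed[OF \<open>complete V\<close>] that]
      bounded_subset[OF \<open>bounded V\<close>, of "cent V F"] by (auto simp: cent_def)
  moreover have near: "\<exists>y\<in>cent V G. norm (x - y) \<le> K * (2 * t)"
    if CB: "F \<in> CB" "G \<in> CB" and "t > 0" and x: "x \<in> cent V F"
      and FG: "\<And>z. z \<in> G \<Longrightarrow> \<exists>w\<in>F. norm (z - w) \<le> t"
      and GF: "\<And>z. z \<in> F \<Longrightarrow> \<exists>w\<in>G. norm (z - w) \<le> t" for F G t x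
  proof -
    \<comment> \<open>One \<open>t\<close> is lost in replacing \<open>F\<close> by \<open>G\<close>
      in the outer radius, the other in comparing the two radii.\<close>
    have "outer_radius x G \<le> outer_radius x F + t"
      using outer_radius_le_add[OF CB FG] .
    also have "\<dots> \<le> rad V F + t" using x by (simp add: cent_def)
    also have "\<dots> \<le> rad V G + 2 * t"
      using rad_le_add[OF \<open>V \<noteq> {}\<close> CB(2,1) GF] by simp
    finally have "outer_radius x G \<le> rad V G + 2 * t" .
    \<comment> \<open>A center of \<open>G\<close> shows that the level \<open>rad V G\<close> is
      attained, as \<open>stable\<close> demands.\<close>
    moreover obtain z where "z \<in> cent V G" using nonempty[OF CB(2)] by blast
    ultimately show ?thesis
      using stable[OF CB(2), of "2 * t" x "rad V G" z] x \<open>t > 0\<close>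
      unfolding cent_eq[OF CB(1)] cent_eq[OF CB(2)] by auto
  qed
  moreover have "\<exists>\<delta>>0. \<forall>G\<in>CB. hausdorff_distance F G < \<delta> \<longrightarrow>
      hausdorff_distance (cent V F) (cent V G) < \<epsilon>" if "F \<in> CB" "\<epsilon> > 0" for F \<epsilon>
  proof (intro exI conjI ballI impI)
    show "\<epsilon> / (2 * K) > 0" using \<open>K > 0\<close> \<open>\<epsilon> > 0\<close> by simp
    fix G assume G: "G \<in> CB" "hausdorff_distance F G < \<epsilon> / (2 * K)"
    then obtain t where t: "0 < t" "t < \<epsilon> / (2 * K)" "\<And>a. a \<in> F \<Longrightarrow> \<exists>b\<in>G. norm (a - b) \<le> t"
      "\<And>b. b \<in> G \<Longrightarrow> \<exists>a\<in>F. norm (b - a) \<le> t"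
      using hausdorff_distance_lessD[OF \<open>F \<in> CB\<close>] by metis
    have "hausdorff_distance (cent V F) (cent V G) \<le> K * (2 * t)"
      by (rule hausdorff_distance_le)
         (use near[OF \<open>F \<in> CB\<close> G(1) t(1) _ t(4,3)] near[OF G(1) \<open>F \<in> CB\<close> t(1) _ t(3,4)]
            \<open>K > 0\<close> t(1) in auto)
    also have "\<dots> < \<epsilon>" using t(2) \<open>K > 0\<close> by (simp add: field_simps)
    finally show "hausdorff_distance (cent V F) (cent V G) < \<epsilon>" .
  qed
  ultimately show ?thesis unfolding hausdorff_continuous_on_CB_def by blast
qed

section \<open>Hoffman's error bound\<close>

text \<open>The largest of the lower bounds and \<open>x - \<eta>\<close> works. Including
  \<open>x - \<eta>\<close> keeps the point within \<open>\<eta>\<close> of \<open>x\<close>, and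
  the set nonempty when \<open>Q\<close> is empty.\<close>

lemma ex_between_near:
  fixes x \<eta> :: real
  assumes "finite P" "finite Q" "0 \<le> \<eta>"
    and "\<And>p q. p \<in> P \<Longrightarrow> q \<in> Q \<Longrightarrow> l q \<le> u p"
    and "\<And>p. p \<in> P \<Longrightarrow> x - \<eta> \<le> u p" "\<And>q. q \<in> Q \<Longrightarrow> l q \<le> x + \<eta>"
  shows "\<exists>t. \<bar>x - t\<bar> \<le> \<eta> \<and> (\<forall>p\<in>P. t \<le> u p) \<and> (\<forall>q\<in>Q. l q \<le> t)"
proof -
  let ?S = "insert (x - \<eta>) (l ` Q)"
  have S: "finite ?S" "?S \<noteq> {}" using assms(2) by auto
  have "Max ?S \<le> x + \<eta>" "x - \<eta> \<le> Max ?S" "\<forall>p\<in>P. Max ?S \<le> u p" "\<forall>q\<in>Q. l q \<le> Max ?S"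
    using assms Max_ge[OF S(1)] by (auto simp: Max_le_iff[OF S])
  then show ?thesis by (intro exI[of _ "Max ?S"]) (auto simp: abs_le_iff)
qed

text \<open>
  Fourier-Motzkin elimination of the coordinate along \<open>e\<close>.  The constraints are indexed by \<open>nat\<close>, so
  that the pairs of constraints arising from the elimination can be encoded in the same index type.
\<close>

lemma hoffman_bound:
  fixes \<phi> :: "nat \<Rightarrow> 'a::real_normed_vector \<Rightarrow> real"
  assumes "finite E" "finite J" "\<And>j. j \<in> J \<Longrightarrow> bounded_linear (\<phi> j)"
  shows "\<exists>K\<ge>0. \<forall>b \<epsilon>. \<forall>x\<in>span E. \<forall>z\<in>span E. 0 \<le> \<epsilon> \<longrightarrow>
    (\<forall>j\<in>J. \<phi> j x \<le> b j + \<epsilon>) \<longrightarrow> (\<forall>j\<in>J. \<phi> j z \<le> b j) \<longrightarrow>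
    (\<exists>y\<in>span E. (\<forall>j\<in>J. \<phi> j y \<le> b j) \<and> norm (x - y) \<le> K * \<epsilon>)"
  using assms
proof (induction E arbitrary: J \<phi> rule: finite_induct)
  case empty
  \<comment> \<open>\<open>span {} = {0}\<close>, so \<open>x\<close> coincides with the feasible
    point \<open>z\<close>.\<close>
  then show ?case by (intro exI[of _ 0]) auto
next
  case (insert e E)
  let ?a = "\<lambda>j. \<phi> j e"
  \<comment> \<open>As conditions on the coefficient of \<open>e\<close>, constraints in
    \<open>P\<close> are upper bounds, those in \<open>Q\<close> are lower bounds, and those in
    \<open>Z\<close> do not involve it.\<close>
  define P where "P = {j \<in> J. ?a j > 0}"
  define Q where "Q = {j \<in> J. ?a j < 0}"
  define Z where "Z = {j \<in> J. ?a j = 0}"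
  have fin: "finite P" "finite Q" "finite Z" and sub: "P \<subseteq> J" "Q \<subseteq> J" "Z \<subseteq> J"
    using \<open>finite J\<close> by (auto simp: P_def Q_def Z_def)
  define J' where "J' = prod_encode ` (P \<times> Q \<union> (\<lambda>j. (j, j)) ` Z)"
  \<comment> \<open>A pair in \<open>P \<times> Q\<close> requires a lower bound not to exceed an
    upper bound; a diagonal pair carries over a constraint of \<open>Z\<close>. The codes cannot
    collide, as \<open>P\<close> and \<open>Q\<close> are disjoint. \<open>comb\<close> acts on
    functionals and right-hand sides alike.\<close>
  define comb where "comb f n = (case prod_decode n of (p, q) \<Rightarrow>
    if p = q then f p else f p / ?a p - f q / ?a q)" for f :: "nat \<Rightarrow> real" and n
  have comb_Z: "comb f (prod_encode (j, j)) = f j" for f j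
    by (simp add: comb_def)
  have comb_PQ: "comb f (prod_encode (p, q)) = f p / ?a p - f q / ?a q" if "p \<in> P" "q \<in> Q" for f p q
    using that by (auto simp: comb_def P_def Q_def)
  have ball_J': "(\<forall>n\<in>J'. R n) \<longleftrightarrow>
      (\<forall>p\<in>P. \<forall>q\<in>Q. R (prod_encode (p, q))) \<and> (\<forall>j\<in>Z. R (prod_encode (j, j)))" for R
    by (auto simp: J'_def)
  define \<psi> where "\<psi> n x = comb (\<lambda>j. \<phi> j x) n" for n x
  have lin: "linear (\<phi> j)" if "j \<in> J" for j
    using insert.prems(2)[OF that] by (rule bounded_linear.linear)
  have \<phi>_add: "\<phi> j (x + t *\<^sub>R e) = \<phi> j x + t * ?a j" if "j \<in> J" for j x t
    using lin[OF that] by (simp add: linear_add linear_scale)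
  have "\<forall>n\<in>J'. bounded_linear (\<psi> n)"
    unfolding ball_J'
  proof (intro conjI ballI)
    fix p q assume pq: "p \<in> P" "q \<in> Q"
    have "bounded_linear (\<lambda>x. \<phi> p x / ?a p - \<phi> q x / ?a q)"
      using insert.prems(2) pq sub
      by (intro bounded_linear_sub bounded_linear_compose[OF bounded_linear_divide]) auto
    then show "bounded_linear (\<psi> (prod_encode (p, q)))"
      using pq by (simp add: \<psi>_def[abs_def] comb_PQ)
  next
    fix j assume "j \<in> Z"
    then show "bounded_linear (\<psi> (prod_encode (j, j)))"
      using insert.prems(2)[of j] sub by (simp add: \<psi>_def[abs_def] comb_Z subset_iff)
  qed
  moreover have "finite J'" using fin by (simp add: J'_def)
  ultimately obtain K where "K \<ge> 0" and K: "\<And>b \<epsilon> x z. \<lbrakk>x \<in> span E; z \<in> span E; 0 \<le> \<epsilon>;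
      \<forall>n\<in>J'. \<psi> n x \<le> b n + \<epsilon>; \<forall>n\<in>J'. \<psi> n z \<le> b n\<rbrakk> \<Longrightarrow>
      \<exists>y\<in>span E. (\<forall>n\<in>J'. \<psi> n y \<le> b n) \<and> norm (x - y) \<le> K * \<epsilon>"
    using insert.IH[of J' \<psi>] by metis
  \<comment> \<open>Since \<open>1 / 0 = 0\<close>, indices in \<open>Z\<close> contribute nothing
    and the sum may range over all of \<open>J\<close>.\<close>
  define D where "D = (\<Sum>j\<in>J. 1 / \<bar>?a j\<bar>)"
  have "D \<ge> 0" by (auto simp: D_def intro: sum_nonneg)
  have D: "1 / \<bar>?a j\<bar> \<le> D" if "j \<in> J" for j
    unfolding D_def using that \<open>finite J\<close> by (intro member_le_sum) auto
  \<comment> \<open>A common Lipschitz constant for all constraints.\<close>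
  define M where "M = (\<Sum>j\<in>J. onorm (\<phi> j))"
  have "M \<ge> 0" using insert.prems(2) by (auto simp: M_def intro!: sum_nonneg onorm_pos_le)
  have M: "\<bar>\<phi> j x - \<phi> j y\<bar> \<le> M * norm (x - y)" if "j \<in> J" for j x y
  proof -
    have "\<bar>\<phi> j x - \<phi> j y\<bar> = norm (\<phi> j (x - y))"
      using lin[OF that] by (simp add: linear_diff)
    also have "\<dots> \<le> onorm (\<phi> j) * norm (x - y)"
      by (rule onorm[OF insert.prems(2)[OF that]])
    also have "\<dots> \<le> M * norm (x - y)"
      unfolding M_def using that \<open>finite J\<close> insert.prems(2)
      by (intro mult_right_mono member_le_sum onorm_pos_le) auto
    finally show ?thesis .
  qed
  \<comment> \<open>Per unit of \<open>\<epsilon>\<close>, \<open>C\<close> bounds the violation of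
    the combined system: \<open>2 * D\<close> from a pair, \<open>1\<close> from a constraint in
    \<open>Z\<close>. \<open>L\<close> bounds the change in the coefficient of \<open>e\<close>: the
    violation \<open>1 + M * (K * C)\<close> left after correcting in \<open>span E\<close>, divided
    by some \<open>\<bar>?a j\<bar>\<close>.\<close>
  define C where "C = 1 + 2 * D"
  define L where "L = D * (1 + M * (K * C))"
  have "C \<ge> 0" "L \<ge> 0" using \<open>D \<ge> 0\<close> \<open>M \<ge> 0\<close> \<open>K \<ge> 0\<close> by (auto simp: C_def L_def)
  have "\<exists>y\<in>span (insert e E). (\<forall>j\<in>J. \<phi> j y \<le> b j) \<and> norm (x - y) \<le> (K * C + L * norm e) * \<epsilon>"
    if x: "x \<in> span (insert e E)" and z: "z \<in> span (insert e E)" and "0 \<le> \<epsilon>"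
      and xb: "\<forall>j\<in>J. \<phi> j x \<le> b j + \<epsilon>" and zb: "\<forall>j\<in>J. \<phi> j z \<le> b j" for b \<epsilon> x z
  proof -
    obtain t where "x - t *\<^sub>R e \<in> span E" using x span_breakdown_eq by blast
    then obtain x' where x': "x' \<in> span E" "x = x' + t *\<^sub>R e"
      by (metis diff_add_cancel)
    obtain s where "z - s *\<^sub>R e \<in> span E" using z span_breakdown_eq by blast
    then obtain z' where z': "z' \<in> span E" "z = z' + s *\<^sub>R e"
      by (metis diff_add_cancel)
    \<comment> \<open>Dividing by coefficients of opposite sign and subtracting cancels
      \<open>r\<close>. This serves \<open>x'\<close> with \<open>\<eta> = \<epsilon>\<close> and
      \<open>z'\<close> with \<open>\<eta> = 0\<close>.\<close>
    have comb_bound: "\<phi> p v / ?a p - \<phi> q v / ?a q \<le> b p / ?a p - b q / ?a q + 2 * D * \<eta>"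
      if "p \<in> P" "q \<in> Q" "0 \<le> \<eta>" "\<forall>j\<in>J. \<phi> j (v + r *\<^sub>R e) \<le> b j + \<eta>" for p q v r \<eta>
    proof -
      have J: "p \<in> J" "q \<in> J" and a: "?a p > 0" "?a q < 0" using that(1,2) by (auto simp: P_def Q_def)
      have "\<phi> p v + r * ?a p \<le> b p + \<eta>" "\<phi> q v + r * ?a q \<le> b q + \<eta>"
        using that(4) J \<phi>_add by auto
      then have "(\<phi> p v + r * ?a p) / ?a p \<le> (b p + \<eta>) / ?a p"
        "(\<phi> q v + r * ?a q) / ?a q \<ge> (b q + \<eta>) / ?a q"
        using a by (auto intro: divide_right_mono divide_right_mono_neg)
      then have 1: "\<phi> p v / ?a p + r \<le> b p / ?a p + \<eta> * (1 / \<bar>?a p\<bar>)"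
        "\<phi> q v / ?a q + r \<ge> b q / ?a q - \<eta> * (1 / \<bar>?a q\<bar>)"
        using a by (auto simp: add_divide_distrib)
      have "\<eta> * (1 / \<bar>?a p\<bar>) \<le> \<eta> * D" "\<eta> * (1 / \<bar>?a q\<bar>) \<le> \<eta> * D"
        by (intro mult_left_mono D J \<open>0 \<le> \<eta>\<close>)+
      with 1 show ?thesis by (simp add: algebra_simps)
    qed
    have "\<forall>n\<in>J'. \<psi> n x' \<le> comb b n + C * \<epsilon>"
      unfolding ball_J' \<psi>_def
    proof (intro conjI ballI)
      fix p q assume pq: "p \<in> P" "q \<in> Q"
      show "comb (\<lambda>j. \<phi> j x') (prod_encode (p, q)) \<le> comb b (prod_encode (p, q)) + C * \<epsilon>"
        using comb_bound[OF pq \<open>0 \<le> \<epsilon>\<close>, of x' t] xb x'(2) \<open>0 \<le> \<epsilon>\<close>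
        by (simp add: comb_PQ[OF pq] C_def algebra_simps)
    next
      fix j assume "j \<in> Z"
      then have "\<phi> j x' \<le> b j + \<epsilon>"
        using xb x'(2) \<phi>_add[of j x' t] by (auto simp: Z_def)
      also have "\<dots> \<le> b j + C * \<epsilon>"
        using \<open>D \<ge> 0\<close> \<open>0 \<le> \<epsilon>\<close> by (simp add: C_def algebra_simps)
      finally show "comb (\<lambda>j. \<phi> j x') (prod_encode (j, j)) \<le> comb b (prod_encode (j, j)) + C * \<epsilon>"
        by (simp add: comb_Z)
    qed
    moreover have "\<forall>n\<in>J'. \<psi> n z' \<le> comb b n"
      unfolding ball_J' \<psi>_def
    proof (intro conjI ballI)
      fix p q assume pq: "p \<in> P" "q \<in> Q"
      show "comb (\<lambda>j. \<phi> j z') (prod_encode (p, q)) \<le> comb b (prod_encode (p, q))"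
        using comb_bound[OF pq, of 0 z' s] zb z'(2) by (simp add: comb_PQ[OF pq])
    next
      fix j assume "j \<in> Z"
      then have "\<phi> j z' \<le> b j"
        using zb z'(2) \<phi>_add[of j z' s] by (auto simp: Z_def)
      then show "comb (\<lambda>j. \<phi> j z') (prod_encode (j, j)) \<le> comb b (prod_encode (j, j))"
        by (simp add: comb_Z)
    qed
    moreover have "0 \<le> C * \<epsilon>" using \<open>0 \<le> C\<close> \<open>0 \<le> \<epsilon>\<close> by simp
    ultimately obtain y where y: "y \<in> span E" "\<forall>n\<in>J'. \<psi> n y \<le> comb b n"
      and xy: "norm (x' - y) \<le> K * (C * \<epsilon>)"
      using K[OF x'(1) z'(1), of "C * \<epsilon>" "comb b"] by blast
    have yPQ: "\<phi> p y / ?a p - \<phi> q y / ?a q \<le> b p / ?a p - b q / ?a q" if "p \<in> P" "q \<in> Q" for p q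
      using y(2) that unfolding ball_J' \<psi>_def by (auto simp: comb_PQ)
    have yZ: "\<phi> j y \<le> b j" if "j \<in> Z" for j
      using y(2) that unfolding ball_J' \<psi>_def by (auto simp: comb_Z)
    \<comment> \<open>The corrected \<open>y\<close> first keeps the old coefficient
      \<open>t\<close> of \<open>e\<close>; the violation found here tells how far \<open>t\<close>
      has to move.\<close>
    have viol: "\<phi> j y + t * ?a j \<le> b j + (1 + M * (K * C)) * \<epsilon>" if "j \<in> J" for j
    proof -
      have "\<phi> j y + t * ?a j \<le> \<phi> j x' + M * norm (x' - y) + t * ?a j"
        using M[OF that, of x' y] by linarith
      also have "\<dots> \<le> b j + \<epsilon> + M * norm (x' - y)"
        using xb that x'(2) \<phi>_add[OF that, of x' t] by auto
      also have "M * norm (x' - y) \<le> M * (K * (C * \<epsilon>))"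
        using xy \<open>M \<ge> 0\<close> by (rule mult_left_mono)
      finally show ?thesis by (simp add: algebra_simps)
    qed
    \<comment> \<open>The bound that constraint \<open>j\<close> puts on the coefficient of
      \<open>e\<close> over \<open>y\<close>: from above for \<open>P\<close>, from below for
      \<open>Q\<close>. By \<open>yPQ\<close> these bounds are compatible.\<close>
    let ?u = "\<lambda>j. (b j - \<phi> j y) / ?a j"
    let ?\<eta> = "(1 + M * (K * C)) * \<epsilon>"
    have "?\<eta> \<ge> 0" using \<open>M \<ge> 0\<close> \<open>K \<ge> 0\<close> \<open>C \<ge> 0\<close> \<open>0 \<le> \<epsilon>\<close> by simp
    have \<eta>_le: "?\<eta> * (1 / \<bar>?a j\<bar>) \<le> L * \<epsilon>" if "j \<in> J" for j
      using mult_left_mono[OF D[OF that] \<open>?\<eta> \<ge> 0\<close>] by (simp add: L_def algebra_simps)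
    have "\<exists>r. \<bar>t - r\<bar> \<le> L * \<epsilon> \<and> (\<forall>p\<in>P. r \<le> ?u p) \<and> (\<forall>q\<in>Q. ?u q \<le> r)"
    proof (rule ex_between_near[OF fin(1,2)])
      show "0 \<le> L * \<epsilon>" using \<open>L \<ge> 0\<close> \<open>0 \<le> \<epsilon>\<close> by simp
      show "?u q \<le> ?u p" if "p \<in> P" "q \<in> Q" for p q
        using yPQ[OF that] by (simp add: diff_divide_distrib)
      show "t - L * \<epsilon> \<le> ?u p" if "p \<in> P" for p
      proof -
        have p: "p \<in> J" "?a p > 0" using that by (auto simp: P_def)
        have "t \<le> (b p - \<phi> p y + ?\<eta>) / ?a p"
          using viol[OF p(1)] p(2) by (simp add: pos_le_divide_eq)
        also have "\<dots> = ?u p + ?\<eta> * (1 / \<bar>?a p\<bar>)" using p(2) by (simp add: add_divide_distrib)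
        finally show ?thesis using \<eta>_le[OF p(1)] by linarith
      qed
      show "?u q \<le> t + L * \<epsilon>" if "q \<in> Q" for q
      proof -
        have q: "q \<in> J" "?a q < 0" using that by (auto simp: Q_def)
        have "?u q = (b q - \<phi> q y + ?\<eta>) / ?a q + ?\<eta> * (1 / \<bar>?a q\<bar>)"
          using q(2) by (simp add: add_divide_distrib)
        also have "(b q - \<phi> q y + ?\<eta>) / ?a q \<le> t"
          using viol[OF q(1)] q(2) by (simp add: neg_divide_le_eq)
        finally show ?thesis using \<eta>_le[OF q(1)] by linarith
      qed
    qed
    then obtain r where r: "\<bar>t - r\<bar> \<le> L * \<epsilon>" "\<And>p. p \<in> P \<Longrightarrow> r \<le> ?u p" "\<And>q. q \<in> Q \<Longrightarrow> ?u q \<le> r"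
      by blast
    show ?thesis
    proof (intro bexI conjI ballI)
      show "y + r *\<^sub>R e \<in> span (insert e E)"
        using y(1) by (auto simp: span_breakdown_eq intro!: exI[of _ r])
      show "\<phi> j (y + r *\<^sub>R e) \<le> b j" if "j \<in> J" for j
      proof -
        have "j \<in> P \<or> j \<in> Q \<or> j \<in> Z" using that by (auto simp: P_def Q_def Z_def)
        then consider "j \<in> P" | "j \<in> Q" | "j \<in> Z" by blast
        then have "\<phi> j y + r * ?a j \<le> b j"
        proof cases
          case 1 then show ?thesis using r(2)[OF 1] by (simp add: P_def pos_le_divide_eq)
        next
          case 2 then show ?thesis using r(3)[OF 2] by (simp add: Q_def neg_divide_le_eq)
        next
          case 3 then show ?thesis using yZ[OF 3] by (simp add: Z_def)
        qed
        then show ?thesis using \<phi>_add[OF that] by simp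
      qed
      have "x - (y + r *\<^sub>R e) = (x' - y) + (t - r) *\<^sub>R e" using x'(2) by (simp add: algebra_simps)
      then have "norm (x - (y + r *\<^sub>R e)) \<le> norm (x' - y) + \<bar>t - r\<bar> * norm e"
        using norm_triangle_ineq[of "x' - y" "(t - r) *\<^sub>R e"] by (simp only: norm_scaleR)
      also have "\<dots> \<le> K * (C * \<epsilon>) + L * \<epsilon> * norm e"
        using xy r(1) by (intro add_mono mult_right_mono) auto
      finally show "norm (x - (y + r *\<^sub>R e)) \<le> (K * C + L * norm e) * \<epsilon>"
        by (simp add: algebra_simps)
    qed
  qed
  moreover have "K * C + L * norm e \<ge> 0" using \<open>K \<ge> 0\<close> \<open>C \<ge> 0\<close> \<open>L \<ge> 0\<close> by simp
  ultimately show ?case by blast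
qed

section \<open>Proximinal subspaces of finite codimension in \<open>c\<^sub>0\<close>\<close>

text \<open>As \<open>Y \<subseteq> W n\<close> and
  \<open>W 0 \<subseteq> span (Y \<union> B)\<close>, each \<open>W n\<close> is determined by its
  trace on the finite-dimensional \<open>span B\<close>; once the dimension of the trace is minimal,
  the chain is constant.\<close>

lemma decreasing_subspaces_stabilize:
  fixes W :: "nat \<Rightarrow> 'a::real_vector set"
  assumes "\<And>n. subspace (W n)" "\<And>m n. m \<le> n \<Longrightarrow> W n \<subseteq> W m"
    and "subspace Y" "\<And>n. Y \<subseteq> W n" "finite B" "W 0 \<subseteq> span (Y \<union> B)"
  obtains N where "\<And>n. N \<le> n \<Longrightarrow> W n = W N"
proof -
  define U where "U n = W n \<inter> span B" for n
  have sub: "subspace (U n)" for n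
    unfolding U_def using assms(1) subspace_span by (rule subspace_inter)
  obtain N where N: "\<And>n. dim (U N) \<le> dim (U n)"
    using ex_has_least_nat[of "\<lambda>_. True" _ "\<lambda>n. dim (U n)"] by auto
  have "W n = W N" if "N \<le> n" for n
  proof -
    have "U n \<subseteq> U N" using assms(2)[OF that] by (auto simp: U_def)
    \<comment> \<open>A basis of the smaller trace extends to one of the larger; minimality of the
      dimension at \<open>N\<close> leaves no room for new vectors.\<close>
    obtain C where C: "C \<subseteq> U n" "independent C" "U n \<subseteq> span C" "card C = dim (U n)"
      by (rule basis_exists)
    then obtain D where D: "C \<subseteq> D" "D \<subseteq> U N" "independent D" "U N \<subseteq> span D"
      using maximal_independent_subset_extend[of C "U N"] \<open>U n \<subseteq> U N\<close> by blast
    have "finite D"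
      using independent_span_bound[OF \<open>finite B\<close> D(3)] D(2) by (auto simp: U_def)
    moreover have "card D \<le> card C"
      using basis_card_eq_dim[OF D(2,4,3)] N[of n] C(4) by simp
    ultimately have "C = D" using D(1) by (simp add: card_seteq)
    then have "U N \<subseteq> U n"
      using D(4) span_minimal[OF C(1) sub] by simp
    have "W N \<subseteq> W n"
    proof
      fix w assume w: "w \<in> W N"
      then have "w \<in> span (Y \<union> B)" using assms(2)[of 0 N] assms(6) by auto
      then obtain y b where yb: "w = y + b" "y \<in> Y" "b \<in> span B"
        using \<open>subspace Y\<close> by (auto simp: span_Un span_eq_iff[THEN iffD2])
      then have "b \<in> W N"
        using subspace_diff[OF assms(1) w, of y] assms(4) by auto
      then have "b \<in> W n" using yb(3) \<open>U N \<subseteq> U n\<close> by (auto simp: U_def)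
      then show "w \<in> W n"
        using yb subspace_add[OF assms(1), of y n b] assms(4)[of n] by auto
    qed
    then show ?thesis using assms(2)[OF that] by blast
  qed
  then show ?thesis by (rule that)
qed

section \<open>Coordinates, norm and completeness of \<open>ell_infty\<close>\<close>

lemma obtain_ell_infty:
  fixes f :: "nat \<Rightarrow> real"
  assumes "\<And>n. \<bar>f n\<bar> \<le> b"
  obtains x :: ell_infty where "\<And>n. apply_bcontfun x n = f n"
proof -
  have "bounded (range f)" using assms by (auto simp: bounded_iff)
  then have "f \<in> range (apply_bcontfun :: ell_infty \<Rightarrow> _)"
    by (simp add: range_apply_ell_infty)
  then show ?thesis using that by auto
qed

lemma norm_ell_infty_le_iff:
  fixes x :: ell_infty
  shows "norm x \<le> b \<longleftrightarrow> (\<forall>n. \<bar>apply_bcontfun x n\<bar> \<le> b)"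
  using norm_bound[of x b] norm_bounded[of x] by (auto intro: order_trans)

lemma bounded_linear_apply_bcontfun: "bounded_linear (\<lambda>x :: ell_infty. apply_bcontfun x n)"
  by (rule bounded_linear_intro[of _ 1]) (use norm_ell_infty_le_iff in auto)

text \<open>The library instance of \<open>complete_space\<close> requires a metric domain, which \<open>nat\<close> is not.\<close>

lemma complete_bcontfun: "complete (UNIV :: ('a::topological_space, 'b::complete_space) bcontfun set)"
proof (rule completeI)
  fix f :: "nat \<Rightarrow> ('a, 'b) bcontfun"
  assume f: "Cauchy f"
  have "uniformly_Cauchy_on UNIV (\<lambda>n. apply_bcontfun (f n))"
  proof (rule uniformly_Cauchy_onI)
    fix e :: real assume "e > 0"
    then obtain M where "\<And>m n. M \<le> m \<Longrightarrow> M \<le> n \<Longrightarrow> dist (f m) (f n) < e"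
      using f unfolding Cauchy_def by blast
    then show "\<exists>M. \<forall>x\<in>UNIV. \<forall>m\<ge>M. \<forall>n\<ge>M. dist (apply_bcontfun (f m) x) (apply_bcontfun (f n) x) < e"
      using dist_fun_lt_imp_dist_val_lt by blast
  qed
  then obtain g where "uniform_limit UNIV (\<lambda>n. apply_bcontfun (f n)) g sequentially"
    using Cauchy_uniformly_convergent uniformly_convergent_on_def by blast
  then show "\<exists>l\<in>UNIV. f \<longlonglongrightarrow> l"
    using uniform_limit_bcontfunE[OF _ sequentially_bot] by (metis UNIV_I)
qed

section \<open>Tails of \<open>c0\<close> and proximinality\<close>

definition c0_tail :: "nat \<Rightarrow> ell_infty set" where
  "c0_tail n = {x \<in> c0. \<forall>k<n. apply_bcontfun x k = 0}"

lemma subspace_c0: "subspace c0"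
  unfolding c0_def by (rule subspaceI) (auto intro: tendsto_add_zero tendsto_mult_right_zero)

lemma subspace_c0_tail: "subspace (c0_tail n)"
  unfolding c0_tail_def
  using subspace_c0 by (auto simp: subspace_def)

text \<open>
  If \<open>w \<notin> Y\<close> lies in \<open>Y + c0_tail n\<close> for all \<open>n\<close>, then a nearest-point residual \<open>w - y\<close>, being a null
  sequence, can be perturbed by a small \<open>t *\<^sub>R s\<close> with \<open>s \<in> c0_tail n\<close> without increasing its norm
  \<open>d\<close>, where \<open>w - y - s \<in> Y\<close>; but the perturbed vector has distance \<open>(1 + t) * d\<close> from \<open>Y\<close>.
\<close>

lemma proximinal_contains_c0_tail:
  assumes "subspace Y" "Y \<subseteq> c0" "finite_codimensional_in Y c0" "proximinal_in Y c0"
  obtains N where "c0_tail N \<subseteq> Y"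
proof -
  define W where "W n = {y + s |y s. y \<in> Y \<and> s \<in> c0_tail n}" for n
  have sub: "subspace (W n)" for n
    unfolding W_def by (rule subspace_sums[OF \<open>subspace Y\<close> subspace_c0_tail])
  have "0 \<in> Y" "\<And>n. 0 \<in> c0_tail n"
    using \<open>subspace Y\<close> subspace_c0_tail subspace_0 by auto
  then have YW: "Y \<subseteq> W n" and tailW: "c0_tail n \<subseteq> W n" for n
    unfolding W_def by force+
  have decr: "W n \<subseteq> W m" if "m \<le> n" for m n
    using that by (force simp: W_def c0_tail_def)
  obtain B where B: "finite B" "span (Y \<union> B) = c0"
    using assms(3) by (auto simp: finite_codimensional_in_def)
  have "W 0 \<subseteq> span (Y \<union> B)"
    unfolding B using \<open>Y \<subseteq> c0\<close> subspace_add[OF subspace_c0] by (auto simp: W_def c0_tail_def)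
  then obtain N where N: "\<And>n. N \<le> n \<Longrightarrow> W n = W N"
    using decreasing_subspaces_stabilize[of W, OF sub decr \<open>subspace Y\<close> YW B(1)] by blast
  have "c0_tail N \<subseteq> Y"
  proof
    fix w assume w: "w \<in> c0_tail N"
    then obtain y where y: "y \<in> Y" "norm (w - y) = (INF y'\<in>Y. norm (w - y'))"
      using assms(4) by (auto simp: proximinal_in_def c0_tail_def)
    define d where "d = norm (w - y)"
    have d_le: "d \<le> norm (w - y')" if "y' \<in> Y" for y'
      unfolding d_def y(2) using that by (intro cINF_lower bdd_belowI2[of _ 0]) auto
    have "w - y \<in> c0"
      using w y(1) \<open>Y \<subseteq> c0\<close> subspace_diff[OF subspace_c0] by (auto simp: c0_tail_def)
    have "d = 0"
    proof (rule ccontr)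
      assume "d \<noteq> 0"
      then have "d > 0" by (simp add: d_def)
      then obtain n0 where n0: "\<And>k. n0 \<le> k \<Longrightarrow> \<bar>apply_bcontfun (w - y) k\<bar> < d / 2"
        using \<open>w - y \<in> c0\<close> LIMSEQ_D[of "apply_bcontfun (w - y)" 0 "d/2"] by (auto simp: c0_def)
      define n where "n = max N n0"
      \<comment> \<open>Both \<open>w\<close> and \<open>y\<close> lie in \<open>W N\<close>, which
        by stabilization equals \<open>W n\<close> for this \<open>n \<ge> N\<close>, chosen beyond
        the place where \<open>w - y\<close> becomes small.\<close>
      have "w - y \<in> W n"
        using N[of n] subspace_diff[OF sub, of w N y] w y(1) YW[of N] tailW[of N] by (auto simp: n_def)
      then obtain y' s where ys: "w - y = y' + s" "y' \<in> Y" "s \<in> c0_tail n"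
        by (auto simp: W_def)
      \<comment> \<open>Chosen so that \<open>t * norm s \<le> d / 2\<close>; the \<open>+ 1\<close>
        covers \<open>s = 0\<close>.\<close>
      define t where "t = d / (2 * (norm s + 1))"
      have "norm s + 1 > 0" using norm_ge_zero[of s] by linarith
      then have "t > 0" "t * norm s \<le> d / 2"
        using \<open>d > 0\<close> by (auto simp: t_def field_simps)
      have "norm (w - y + t *\<^sub>R s) \<le> d"
        unfolding norm_ell_infty_le_iff
      proof
        fix k
        show "\<bar>apply_bcontfun (w - y + t *\<^sub>R s) k\<bar> \<le> d"
        \<comment> \<open>Below \<open>n\<close> the perturbation vanishes; from \<open>n\<close> on
          both summands are at most \<open>d / 2\<close>.\<close>
        proof (cases "k < n")
          case True
          then have "apply_bcontfun s k = 0" using ys(3) by (simp add: c0_tail_def)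
          then show ?thesis using norm_bounded[of "w - y" k] by (simp add: d_def)
        next
          case False
          have "\<bar>t * apply_bcontfun s k\<bar> \<le> t * norm s"
            using norm_bounded[of s k] \<open>t > 0\<close> by (simp add: abs_mult)
          moreover have "\<bar>apply_bcontfun (w - y) k\<bar> < d / 2"
            using n0[of k] False by (simp add: n_def)
          ultimately show ?thesis
            using \<open>t * norm s \<le> d / 2\<close>
              abs_triangle_ineq[of "apply_bcontfun (w - y) k" "t * apply_bcontfun s k"] by simp
        qed
      qed
      \<comment> \<open>Substituting \<open>s = w - y - y'\<close> and extracting
        \<open>1 + t\<close> exhibits another point of \<open>Y\<close>, whose distance from
        \<open>w\<close> is at least \<open>d\<close>.\<close>
      moreover have "w - y + t *\<^sub>R s = (1 + t) *\<^sub>R (w - (y + (t / (1 + t)) *\<^sub>R y'))"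
      proof -
        have "1 + t \<noteq> 0" using \<open>t > 0\<close> by simp
        then have "(1 + t) *\<^sub>R (w - (y + (t / (1 + t)) *\<^sub>R y')) = (1 + t) *\<^sub>R (w - y) - t *\<^sub>R y'"
          by (simp add: scaleR_diff_right scaleR_add_right)
        also have "\<dots> = w - y + t *\<^sub>R s" by (simp add: ys(1) algebra_simps)
        finally show ?thesis ..
      qed
      moreover have "(1 + t) * d \<le> (1 + t) * norm (w - (y + (t / (1 + t)) *\<^sub>R y'))"
        using \<open>subspace Y\<close> y(1) ys(2) \<open>t > 0\<close>
        by (intro mult_left_mono d_le subspace_add subspace_scale) auto
      ultimately have "(1 + t) * d \<le> d"
        using \<open>t > 0\<close> by (simp only: norm_scaleR abs_of_pos[of "1 + t"] add_pos_pos zero_less_one)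
      then show False using mult_pos_pos[OF \<open>t > 0\<close> \<open>d > 0\<close>] by (simp add: distrib_right)
    qed
    then show "w \<in> Y" using y(1) by (simp add: d_def)
  qed
  then show ?thesis by (rule that)
qed

section \<open>Box constraints in \<open>Y\<close>\<close>

lemma ell_infty_eq_sum_units:
  fixes x :: ell_infty
  assumes "\<And>n. N \<le> n \<Longrightarrow> apply_bcontfun x n = 0"
    and \<delta>: "\<And>i n. apply_bcontfun (\<delta> i :: ell_infty) n = (if n = i then 1 else 0)"
  shows "x = (\<Sum>i<N. apply_bcontfun x i *\<^sub>R \<delta> i)"
proof (rule bcontfun_eqI)
  fix n
  interpret bounded_linear "\<lambda>x :: ell_infty. apply_bcontfun x n"
    by (rule bounded_linear_apply_bcontfun)
  have "apply_bcontfun (\<Sum>i<N. apply_bcontfun x i *\<^sub>R \<delta> i) n =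
      (\<Sum>i<N. if n = i then apply_bcontfun x i else 0)"
    unfolding sum by (intro sum.cong) (auto simp: \<delta>)
  then show "apply_bcontfun x n = apply_bcontfun (\<Sum>i<N. apply_bcontfun x i *\<^sub>R \<delta> i) n"
    using assms(1) by simp
qed

text \<open>Provides the finite spanning set for Hoffman's bound: \<open>T\<close> lies in the span
  of the first \<open>N\<close> unit sequences, so its independent subsets are finite.\<close>

lemma finite_basis_of_finitely_supported:
  fixes T :: "ell_infty set"
  assumes "subspace T" "\<And>x n. x \<in> T \<Longrightarrow> N \<le> n \<Longrightarrow> apply_bcontfun x n = 0"
  obtains E where "finite E" "span E = T"
proof -
  have "\<exists>x :: ell_infty. \<forall>n. apply_bcontfun x n = (if n = i then 1 else 0)" for i
  proof -
    have "\<bar>(if n = i then 1 else 0) :: real\<bar> \<le> 1" for n by simp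
    from obtain_ell_infty[of "\<lambda>n. if n = i then 1 else 0", OF this] show ?thesis by blast
  qed
  then obtain \<delta> :: "nat \<Rightarrow> ell_infty"
    where \<delta>: "\<And>i n. apply_bcontfun (\<delta> i) n = (if n = i then 1 else 0)" by metis
  have T: "T \<subseteq> span (\<delta> ` {..<N})"
  proof
    fix x assume "x \<in> T"
    then have "x = (\<Sum>i<N. apply_bcontfun x i *\<^sub>R \<delta> i)"
      by (intro ell_infty_eq_sum_units assms(2) \<delta>)
    also have "\<dots> \<in> span (\<delta> ` {..<N})"
      by (intro span_sum span_scale span_base) auto
    finally show "x \<in> span (\<delta> ` {..<N})" .
  qed
  obtain E where E: "E \<subseteq> T" "independent E" "T \<subseteq> span E"
    by (rule maximal_independent_subset)
  have "finite E" using independent_span_bound[OF _ E(2), of "\<delta> ` {..<N}"] E(1) T by auto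
  moreover have "span E = T" using span_minimal[OF E(1) \<open>subspace T\<close>] E(3) by auto
  ultimately show ?thesis by (rule that)
qed

text \<open>An error bound of Hoffman type for boxes. \<open>K\<close> is fixed before
  \<open>lo\<close> and \<open>hi\<close>, hence uniform over all boxes, which later depend on
  \<open>F\<close> and the radius; \<open>z\<close> witnesses that the box meets
  \<open>S\<close>.\<close>

definition box_stable :: "ell_infty set \<Rightarrow> nat set \<Rightarrow> real \<Rightarrow> bool" where
  "box_stable S I K \<longleftrightarrow> (\<forall>lo hi \<epsilon>. \<forall>x\<in>S. \<forall>z\<in>S. 0 \<le> \<epsilon> \<longrightarrow>
    (\<forall>n\<in>I. lo n - \<epsilon> \<le> apply_bcontfun x n \<and> apply_bcontfun x n \<le> hi n + \<epsilon>) \<longrightarrow>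
    (\<forall>n\<in>I. lo n \<le> apply_bcontfun z n \<and> apply_bcontfun z n \<le> hi n) \<longrightarrow>
    (\<exists>y\<in>S. (\<forall>n\<in>I. lo n \<le> apply_bcontfun y n \<and> apply_bcontfun y n \<le> hi n) \<and> norm (x - y) \<le> K * \<epsilon>))"

lemma box_stableI:
  assumes "\<And>lo hi \<epsilon> x z. \<lbrakk>x \<in> S; z \<in> S; 0 \<le> \<epsilon>;
    \<And>n. n \<in> I \<Longrightarrow> lo n - \<epsilon> \<le> apply_bcontfun x n \<and> apply_bcontfun x n \<le> hi n + \<epsilon>;
    \<And>n. n \<in> I \<Longrightarrow> lo n \<le> apply_bcontfun z n \<and> apply_bcontfun z n \<le> hi n\<rbrakk> \<Longrightarrow>
    \<exists>y\<in>S. (\<forall>n\<in>I. lo n \<le> apply_bcontfun y n \<and> apply_bcontfun y n \<le> hi n) \<and> norm (x - y) \<le> K * \<epsilon>"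
  shows "box_stable S I K"
  unfolding box_stable_def by (intro allI ballI impI, rule assms) blast+

lemma box_stableD:
  assumes "box_stable S I K" "x \<in> S" "z \<in> S" "0 \<le> \<epsilon>"
    and "\<And>n. n \<in> I \<Longrightarrow> lo n - \<epsilon> \<le> apply_bcontfun x n \<and> apply_bcontfun x n \<le> hi n + \<epsilon>"
    and "\<And>n. n \<in> I \<Longrightarrow> lo n \<le> apply_bcontfun z n \<and> apply_bcontfun z n \<le> hi n"
  obtains y where "y \<in> S" "\<And>n. n \<in> I \<Longrightarrow> lo n \<le> apply_bcontfun y n \<and> apply_bcontfun y n \<le> hi n"
    "norm (x - y) \<le> K * \<epsilon>"
  using assms(1)[unfolded box_stable_def, rule_format, OF assms(2-4), of lo hi] assms(5,6) by blast

text \<open>A two-sided bound on coordinate \<open>n\<close> splits into two linear inequalities,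
  with index \<open>2 * n\<close> for the upper and \<open>2 * n + 1\<close> for the negated lower
  bound; Hoffman's bound applies to these.\<close>

lemma box_stable_finitely_supported:
  fixes T :: "ell_infty set"
  assumes "subspace T" "\<And>x n. x \<in> T \<Longrightarrow> N \<le> n \<Longrightarrow> apply_bcontfun x n = 0"
  shows "\<exists>K\<ge>0. box_stable T {..<N} K"
proof -
  obtain E where E: "finite E" "span E = T"
    using finite_basis_of_finitely_supported[OF assms] by blast
  define \<phi> :: "nat \<Rightarrow> ell_infty \<Rightarrow> real" where
    "\<phi> j x = (if even j then apply_bcontfun x (j div 2) else - apply_bcontfun x (j div 2))" for j x
  have "bounded_linear (\<phi> j)" for j
    unfolding \<phi>_def
    by (cases "even j") (simp_all add: bounded_linear_apply_bcontfun bounded_linear_minus)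
  then obtain K where "K \<ge> 0" and K: "\<And>b \<epsilon> x z. \<lbrakk>x \<in> T; z \<in> T; 0 \<le> \<epsilon>;
      \<forall>j\<in>{..<2*N}. \<phi> j x \<le> b j + \<epsilon>; \<forall>j\<in>{..<2*N}. \<phi> j z \<le> b j\<rbrakk> \<Longrightarrow>
      \<exists>y\<in>T. (\<forall>j\<in>{..<2*N}. \<phi> j y \<le> b j) \<and> norm (x - y) \<le> K * \<epsilon>"
    using hoffman_bound[OF E(1), of "{..<2*N}" \<phi>] unfolding E(2) by (metis finite_lessThan)
  \<comment> \<open>Used with \<open>\<epsilon>\<close> for \<open>x\<close> and with
    \<open>0\<close> for the exact constraints on \<open>z\<close> and on the result.\<close>
  have ball: "(\<forall>j\<in>{..<2*N}. \<phi> j x \<le> (if even j then hi (j div 2) else - lo (j div 2)) + \<epsilon>) \<longleftrightarrow>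
      (\<forall>n<N. lo n - \<epsilon> \<le> apply_bcontfun x n \<and> apply_bcontfun x n \<le> hi n + \<epsilon>)" (is "?L \<longleftrightarrow> ?R")
    for lo hi :: "nat \<Rightarrow> real" and \<epsilon> x
  proof
    assume L: ?L
    show ?R
    proof (intro allI impI)
      fix n assume "n < N"
      then show "lo n - \<epsilon> \<le> apply_bcontfun x n \<and> apply_bcontfun x n \<le> hi n + \<epsilon>"
        using L[THEN bspec, of "2 * n"] L[THEN bspec, of "2 * n + 1"] by (simp add: \<phi>_def)
    qed
  next
    assume R: ?R
    show ?L
    proof
      fix j assume "j \<in> {..<2*N}"
      then have "j div 2 < N" by auto
      with R show "\<phi> j x \<le> (if even j then hi (j div 2) else - lo (j div 2)) + \<epsilon>"
        unfolding \<phi>_def by (smt (verit))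
    qed
  qed
  have "box_stable T {..<N} K"
  proof (rule box_stableI)
    fix lo hi :: "nat \<Rightarrow> real" and \<epsilon> x z
    assume "x \<in> T" "z \<in> T" "0 \<le> \<epsilon>"
      and "\<And>n. n \<in> {..<N} \<Longrightarrow> lo n - \<epsilon> \<le> apply_bcontfun x n \<and> apply_bcontfun x n \<le> hi n + \<epsilon>"
      and "\<And>n. n \<in> {..<N} \<Longrightarrow> lo n \<le> apply_bcontfun z n \<and> apply_bcontfun z n \<le> hi n"
    then show "\<exists>y\<in>T. (\<forall>n\<in>{..<N}. lo n \<le> apply_bcontfun y n \<and> apply_bcontfun y n \<le> hi n) \<and>
        norm (x - y) \<le> K * \<epsilon>"
      using K[of x z \<epsilon> "\<lambda>j. if even j then hi (j div 2) else - lo (j div 2)"]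
        ball[of x hi lo \<epsilon>] ball[of _ hi lo 0]
      by (simp add: Ball_def)
  qed
  with \<open>K \<ge> 0\<close> show ?thesis by blast
qed

text \<open>From \<open>N\<close> on, coordinates may be altered without leaving \<open>Y\<close> as
  long as the sequence stays null, so head and tail are repaired separately, at cost
  \<open>K * \<epsilon>\<close> and \<open>\<epsilon>\<close>; \<open>K + 1\<close> dominates both
  and is positive.\<close>

lemma ex_box_stable:
  assumes "subspace Y" "Y \<subseteq> c0" "c0_tail N \<subseteq> Y"
  shows "\<exists>K>0. box_stable Y UNIV K"
proof -
  \<comment> \<open>By \<open>head\<close> below, a copy inside \<open>Y\<close> of its projection
    to the first \<open>N\<close> coordinates.\<close>
  define T where "T = {y \<in> Y. \<forall>n\<ge>N. apply_bcontfun y n = 0}"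
  have "subspace T" using \<open>subspace Y\<close> by (auto simp: T_def subspace_def)
  have T0: "apply_bcontfun x n = 0" if "x \<in> T" "N \<le> n" for x n
    using that by (simp add: T_def)
  obtain K where "K \<ge> 0" and K: "box_stable T {..<N} K"
    using box_stable_finitely_supported[OF \<open>subspace T\<close> T0] by blast
  have c0D: "apply_bcontfun x \<longlonglongrightarrow> 0" if "x \<in> Y" for x
    using that \<open>Y \<subseteq> c0\<close> by (auto simp: c0_def)
  \<comment> \<open>For null sequences, membership in \<open>Y\<close> is decided by the first
    \<open>N\<close> coordinates.\<close>
  have mem_Y: "v \<in> Y" if "y \<in> Y" "apply_bcontfun v \<longlonglongrightarrow> 0"
    "\<And>n. n < N \<Longrightarrow> apply_bcontfun v n = apply_bcontfun y n" for v y
  proof -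
    have "v - y \<in> c0_tail N"
      using tendsto_diff[OF that(2) c0D[OF that(1)]] that(3) by (simp add: c0_tail_def c0_def)
    then show ?thesis using subspace_add[OF \<open>subspace Y\<close> _ that(1), of "v - y"] assms(3) by auto
  qed
  have head: "\<exists>h\<in>T. \<forall>n<N. apply_bcontfun h n = apply_bcontfun y n" if "y \<in> Y" for y
  proof -
    have "\<bar>if n < N then apply_bcontfun y n else 0\<bar> \<le> norm y" for n
      using norm_bounded[of y n] by simp
    from obtain_ell_infty[of "\<lambda>n. if n < N then apply_bcontfun y n else 0", OF this]
    obtain h :: ell_infty
      where h: "\<And>n. apply_bcontfun h n = (if n < N then apply_bcontfun y n else 0)"
      by blast
    have "apply_bcontfun h \<longlonglongrightarrow> 0"
      by (rule tendsto_eventually) (auto simp: eventually_sequentially h intro!: exI[of _ N])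
    then have "h \<in> Y" by (rule mem_Y[OF that]) (simp add: h)
    then show ?thesis by (intro bexI[of _ h]) (auto simp: T_def h)
  qed
  have "box_stable Y UNIV (K + 1)"
  proof (rule box_stableI)
    fix lo hi :: "nat \<Rightarrow> real" and \<epsilon> x z
    assume x: "x \<in> Y" and z: "z \<in> Y" and "0 \<le> \<epsilon>"
      and xb': "\<And>n. n \<in> UNIV \<Longrightarrow> lo n - \<epsilon> \<le> apply_bcontfun x n \<and> apply_bcontfun x n \<le> hi n + \<epsilon>"
      and zb': "\<And>n. n \<in> UNIV \<Longrightarrow> lo n \<le> apply_bcontfun z n \<and> apply_bcontfun z n \<le> hi n"
    note xb = xb'[OF UNIV_I] and zb = zb'[OF UNIV_I]
    obtain x' z' where x': "x' \<in> T" "\<And>n. n < N \<Longrightarrow> apply_bcontfun x' n = apply_bcontfun x n"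
      and z': "z' \<in> T" "\<And>n. n < N \<Longrightarrow> apply_bcontfun z' n = apply_bcontfun z n"
      using head[OF x] head[OF z] by metis
    obtain h where h: "h \<in> T" "\<And>n. n < N \<Longrightarrow> lo n \<le> apply_bcontfun h n \<and> apply_bcontfun h n \<le> hi n"
      and xh: "norm (x' - h) \<le> K * \<epsilon>"
      by (rule box_stableD[OF K x'(1) z'(1) \<open>0 \<le> \<epsilon>\<close>, of lo hi])
        (use xb zb x'(2) z'(2) in auto)
    define clamp where "clamp n = max (lo n) (min (hi n) (apply_bcontfun x n))" for n
    have clamp: "lo n \<le> clamp n" "clamp n \<le> hi n" "\<bar>apply_bcontfun x n - clamp n\<bar> \<le> \<epsilon>"
      \<comment> \<open>the clamped value lies between \<open>x n\<close> and the feasible value \<open>z n\<close>\<close>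
      "\<bar>clamp n\<bar> \<le> \<bar>apply_bcontfun x n\<bar> + \<bar>apply_bcontfun z n\<bar>" for n
      using xb[of n] zb[of n] \<open>0 \<le> \<epsilon>\<close> by (auto simp: clamp_def max_def min_def)
    have "\<bar>if n < N then apply_bcontfun h n else clamp n\<bar> \<le> norm h + (norm x + norm z)" for n
      using norm_bounded[of h n] norm_bounded[of x n] norm_bounded[of z n] clamp(4)[of n]
      by (auto; linarith)
    from obtain_ell_infty[of "\<lambda>n. if n < N then apply_bcontfun h n else clamp n", OF this]
    obtain y :: ell_infty
      where y: "\<And>n. apply_bcontfun y n = (if n < N then apply_bcontfun h n else clamp n)"
      by blast
    \<comment> \<open>The box bounds are arbitrary; the decay of the clamped tail comes from the
      null sequences \<open>x\<close> and \<open>z\<close>.\<close>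
    have "apply_bcontfun y \<longlonglongrightarrow> 0"
    proof (rule Lim_null_comparison)
      show "\<forall>\<^sub>F n in sequentially. norm (apply_bcontfun y n) \<le>
          \<bar>apply_bcontfun x n\<bar> + \<bar>apply_bcontfun z n\<bar>"
        using clamp(4) by (auto simp: eventually_sequentially y intro!: exI[of _ N])
      show "(\<lambda>n. \<bar>apply_bcontfun x n\<bar> + \<bar>apply_bcontfun z n\<bar>) \<longlonglongrightarrow> 0"
        using tendsto_add[OF tendsto_rabs[OF c0D[OF x]] tendsto_rabs[OF c0D[OF z]]] by simp
    qed
    then have "y \<in> Y"
      using mem_Y[of h y] h(1) by (simp add: y T_def)
    moreover have "\<forall>n. lo n \<le> apply_bcontfun y n \<and> apply_bcontfun y n \<le> hi n"
      using h(2) clamp by (simp add: y)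
    moreover have "norm (x - y) \<le> (K + 1) * \<epsilon>"
      unfolding norm_ell_infty_le_iff
    proof
      fix n
      have "0 \<le> K * \<epsilon>" using \<open>K \<ge> 0\<close> \<open>0 \<le> \<epsilon>\<close> by simp
      then have "\<bar>apply_bcontfun x n - clamp n\<bar> \<le> (K + 1) * \<epsilon>"
        using clamp(3)[of n] by (simp add: distrib_right)
      moreover have "\<bar>apply_bcontfun x n - apply_bcontfun h n\<bar> \<le> (K + 1) * \<epsilon>" if "n < N"
        using norm_bounded[of "x' - h" n] xh x'(2)[OF that] \<open>0 \<le> \<epsilon>\<close> by (simp add: distrib_right)
      ultimately show "\<bar>apply_bcontfun (x - y) n\<bar> \<le> (K + 1) * \<epsilon>"
        by (simp add: y)
    qed
    ultimately show "\<exists>y\<in>Y. (\<forall>n\<in>UNIV. lo n \<le> apply_bcontfun y n \<and> apply_bcontfun y n \<le> hi n) \<and>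
        norm (x - y) \<le> (K + 1) * \<epsilon>" by blast
  qed
  with \<open>K \<ge> 0\<close> show ?thesis by (intro exI[of _ "K + 1"]) simp
qed

text \<open>In the supremum norm, \<open>norm (v - z) \<le> r\<close> is a condition on each
  coordinate; exchanging the quantifiers over \<open>z\<close> and \<open>n\<close> leaves only the
  extreme values of \<open>F\<close> in each coordinate.\<close>

lemma outer_radius_ell_infty_le_iff:
  fixes F :: "ell_infty set"
  assumes "F \<in> CB"
  shows "outer_radius v F \<le> r \<longleftrightarrow>
    (\<forall>n. (SUP z\<in>F. apply_bcontfun z n) - r \<le> apply_bcontfun v n \<and>
      apply_bcontfun v n \<le> (INF z\<in>F. apply_bcontfun z n) + r)"
proof -
  have "F \<noteq> {}" "bounded F" using assms by (auto simp: CB_def)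
  then obtain M where M: "\<And>z. z \<in> F \<Longrightarrow> norm z \<le> M" by (auto simp: bounded_iff)
  have "- M \<le> apply_bcontfun z n" "apply_bcontfun z n \<le> M" if "z \<in> F" for z n
    using norm_bounded[of z n] M[OF that] by simp_all
  then have "bdd_above ((\<lambda>z. apply_bcontfun z n) ` F)" "bdd_below ((\<lambda>z. apply_bcontfun z n) ` F)" for n
    by (meson bdd_aboveI2 bdd_belowI2)+
  note sup = cSUP_le_iff[OF \<open>F \<noteq> {}\<close> this(1)] and inf = le_cINF_iff[OF \<open>F \<noteq> {}\<close> this(2)]
  have "(SUP z\<in>F. apply_bcontfun z n) - r \<le> apply_bcontfun v n \<longleftrightarrow>
      (\<forall>z\<in>F. apply_bcontfun z n - r \<le> apply_bcontfun v n)" for n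
    using sup[of n "apply_bcontfun v n + r"] by (simp add: diff_le_eq)
  moreover have "apply_bcontfun v n \<le> (INF z\<in>F. apply_bcontfun z n) + r \<longleftrightarrow>
      (\<forall>z\<in>F. apply_bcontfun v n \<le> apply_bcontfun z n + r)" for n
    using inf[of "apply_bcontfun v n - r" n] by (simp add: diff_le_eq)
  moreover have "\<bar>apply_bcontfun (v - z) n\<bar> \<le> r \<longleftrightarrow>
      apply_bcontfun z n - r \<le> apply_bcontfun v n \<and> apply_bcontfun v n \<le> apply_bcontfun z n + r" for z n
    by (auto simp: abs_le_iff)
  ultimately show ?thesis
    unfolding outer_radius_le_iff[OF assms] norm_ell_infty_le_iff by (simp only:) blast
qed

theorem proposition4p5:
  fixes Y :: "ell_infty set"
  assumes "subspace Y" and "closed Y" and "Y \<subseteq> c0"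
    and "finite_codimensional_in Y c0"
    and "proximinal_in Y c0"
  shows "hausdorff_continuous_on_CB (cent (Y \<inter> cball 0 1))"
proof -
  let ?V = "Y \<inter> cball 0 1"
  obtain N where N: "c0_tail N \<subseteq> Y"
    using proximinal_contains_c0_tail[OF assms(1,3-5)] .
  obtain K where "K > 0" and K: "box_stable Y UNIV K"
    using ex_box_stable[OF assms(1,3) N] by blast
  show ?thesis
  proof (rule hausdorff_continuous_cent[OF _ _ _ \<open>K > 0\<close>])
    show "complete ?V"
      using complete_Int_closed[OF complete_bcontfun, of ?V] \<open>closed Y\<close> by (simp add: closed_Int)
    show "?V \<noteq> {}" using subspace_0[OF \<open>subspace Y\<close>] by auto
    show "bounded ?V" by (meson bounded_Int bounded_cball)
    fix F :: "ell_infty set" and r \<epsilon> x z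
    assume F: "F \<in> CB" and "0 \<le> \<epsilon>" and x: "x \<in> ?V" "outer_radius x F \<le> r + \<epsilon>"
      and z: "z \<in> ?V" "outer_radius z F \<le> r"
    \<comment> \<open>The unit ball is itself a box, so its bounds are merged with those from
      \<open>F\<close>; the corrected point then stays in \<open>?V\<close>.\<close>
    define lo where "lo n = max (- 1) ((SUP z\<in>F. apply_bcontfun z n) - r)" for n
    define hi where "hi n = min 1 ((INF z\<in>F. apply_bcontfun z n) + r)" for n
    have box: "v \<in> ?V \<and> outer_radius v F \<le> r \<longleftrightarrow>
        v \<in> Y \<and> (\<forall>n. lo n \<le> apply_bcontfun v n \<and> apply_bcontfun v n \<le> hi n)" for v
      unfolding outer_radius_ell_infty_le_iff[OF F] lo_def hi_def
      by (auto simp: norm_ell_infty_le_iff abs_le_iff minus_le_iff)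
    obtain y where "y \<in> Y" "\<And>n. lo n \<le> apply_bcontfun y n \<and> apply_bcontfun y n \<le> hi n"
      "norm (x - y) \<le> K * \<epsilon>"
    proof (rule box_stableD[OF K _ _ \<open>0 \<le> \<epsilon>\<close>, of x z lo hi])
      show "lo n - \<epsilon> \<le> apply_bcontfun x n \<and> apply_bcontfun x n \<le> hi n + \<epsilon>" for n
      proof -
        \<comment> \<open>The unit-ball bounds hold for \<open>x\<close> exactly; only those coming
          from \<open>F\<close> are relaxed by \<open>\<epsilon>\<close>.\<close>
        have "\<bar>apply_bcontfun x n\<bar> \<le> 1" using x(1) by (simp add: norm_ell_infty_le_iff)
        then show ?thesis
          using x(2)[unfolded outer_radius_ell_infty_le_iff[OF F], rule_format, of n] \<open>0 \<le> \<epsilon>\<close>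
          by (auto simp: lo_def hi_def)
      qed
      show "lo n \<le> apply_bcontfun z n \<and> apply_bcontfun z n \<le> hi n" for n
        using box[of z] z by blast
    qed (use x z in auto)
    then show "\<exists>y\<in>?V. outer_radius y F \<le> r \<and> norm (x - y) \<le> K * \<epsilon>"
      using box by blast
  qed
qed

end
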